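(* There exists an absolute constant $c>0$ such that for all $m,n\in\mathbb{N}$ the following inequality holds: $$d_{\lfloor mn/2\rfloor}\bigl(B_{1,\infty}^{n,m},\ell_{2,1}^{n,m}\bigr)\ge cm.$$
   Context: Let $N=mn$. The coordinate set $\{1,\ldots,N\}$ is split into $m$ blocks $\Delta_s=\{(s-1)n+1,\ldots,sn\}$, $s=1,\ldots,m$, each of cardinality $n$. For $x\in\mathbb{R}^N$, let $x[s]=(x(i))_{i\in\Delta_s}\in\mathbb{R}^n$ be its restriction to the $s$-th block. For $1\le p,q\le\infty$ the mixed norm on $\mathbb{R}^N$ is $$\|x\|_{\ell_{p,q}^{n,m}}=\|y\|_{\ell_q^m},\quad y=(\|x[s]\|_{\ell_p^n})_{s=1}^m,$$ where $\|\cdot\|_{\ell_p^k}$ is the usual $\ell_p$ norm on $\mathbb{R}^k$. The space $\ell_{p,q}^{n,m}$ is $\mathbb{R}^N$ with this norm, and $B_{p,q}^{n,m}$ is its closed unit ball. In particular $B_{1,\infty}^{n,m}$ is the Cartesian product of $m$ octahedra $B_1^n$ (unit balls of $\ell_1^n$). The Kolmogorov width of a subset $M$ of a normed space $X$ is $$d_k(M,X)=\inf_{\substack{L\subset X\\ \dim L\le k}}\ \sup_{x\in M}\ \inf_{y\in L}\|x-y\|_X,$$ where $L$ ranges over linear subspaces of $X$. *)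

theory Defs
  imports "HOL-Analysis.Analysis" "HOL-Library.Function_Algebras"
begin

text \<open>
  Pointwise scalar multiplication complements the pointwise addition of
  \<^theory>\<open>HOL-Library.Function_Algebras\<close>, so that \<^const>\<open>subspace\<close>, \<^const>\<open>span\<close>
  and \<^const>\<open>dim\<close> apply to real functions.
\<close>

instantiation "fun" :: (type, scaleR) scaleR
begin

definition scaleR_fun :: "real \<Rightarrow> ('a \<Rightarrow> 'b) \<Rightarrow> 'a \<Rightarrow> 'b"
  where "scaleR_fun r f = (\<lambda>i. r *\<^sub>R f i)"

instance ..

end

instance "fun" :: (type, real_vector) real_vector
  by standard
    (simp_all add: fun_eq_iff scaleR_fun_def scaleR_add_right scaleR_add_left)

text \<open>
  Since the dimension $N = mn$ varies inside the statement, $\mathbb{R}^N$ is rendered as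
  the space of sequences that vanish outside \<open>{1..N}\<close>.
\<close>

definition coord_space :: "nat \<Rightarrow> (nat \<Rightarrow> real) set"
  where "coord_space N = {x. \<forall>i. i \<notin> {1..N} \<longrightarrow> x i = 0}"

definition block :: "nat \<Rightarrow> nat \<Rightarrow> nat set"
  where "block n s = {(s - 1) * n + 1 .. s * n}"

text \<open>
  The \<open>\<ell>\<^sub>p\<close> norm of the restriction of \<open>x\<close> to a finite index set \<open>A\<close>, for \<open>1 \<le> p \<le> \<infinity>\<close>.
  Inserting \<open>0\<close> only matters for empty \<open>A\<close>, where \<^const>\<open>Max\<close> would be unspecified.
\<close>

definition lp_norm :: "ereal \<Rightarrow> nat set \<Rightarrow> (nat \<Rightarrow> real) \<Rightarrow> real"
  where "lp_norm p A x =
    (if p = \<infinity> then Max (insert 0 ((\<lambda>i. \<bar>x i\<bar>) ` A))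
     else (\<Sum>i\<in>A. \<bar>x i\<bar> powr real_of_ereal p) powr (1 / real_of_ereal p))"

definition mixed_norm :: "ereal \<Rightarrow> ereal \<Rightarrow> nat \<Rightarrow> nat \<Rightarrow> (nat \<Rightarrow> real) \<Rightarrow> real"
  where "mixed_norm p q n m x = lp_norm q {1..m} (\<lambda>s. lp_norm p (block n s) x)"

definition mixed_ball :: "ereal \<Rightarrow> ereal \<Rightarrow> nat \<Rightarrow> nat \<Rightarrow> (nat \<Rightarrow> real) set"
  where "mixed_ball p q n m = {x \<in> coord_space (m * n). mixed_norm p q n m x \<le> 1}"

text \<open>
  The Kolmogorov width \<open>d\<^sub>k(M, X)\<close>, where \<open>X\<close> is a linear subspace of the ambient type and
  \<open>\<nu>\<close> is a norm on \<open>X\<close>. As \<^const>\<open>dim\<close> is \<open>0\<close> on infinite-dimensional subspaces, finite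
  dimension of \<open>L\<close> is required separately. Values are extended reals so that the suprema and
  infima need no boundedness side conditions.
\<close>

definition kolmogorov_width ::
    "nat \<Rightarrow> 'a::real_vector set \<Rightarrow> 'a set \<Rightarrow> ('a \<Rightarrow> real) \<Rightarrow> ereal"
  where "kolmogorov_width k M X \<nu> =
    (INF L \<in> {L. subspace L \<and> L \<subseteq> X \<and> (\<exists>B. finite B \<and> L = span B) \<and> dim L \<le> k}.
       SUP x\<in>M. INF y\<in>L. ereal (\<nu> (x - y)))"

end

theory Submission
  imports Defs
begin

text \<open>
  Let \<open>L\<close> be a subspace of dimension at most \<open>N/2\<close>. By duality it suffices to find a vertex \<open>x\<close> of
  the product of octahedra and a vector \<open>z\<close> orthogonal to \<open>L\<close> whose blocks have Euclidean norm at
  most \<open>2\<close>, with \<open>\<langle>z, x\<rangle> \<ge> m/4\<close>. Both are built by a walk with one step per block. A block \<open>s\<close> is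
  frozen once \<open>z[s]\<close> has norm greater than \<open>1\<close>. Let \<open>Q\<close> be the orthogonal projection onto the
  vectors that are orthogonal to \<open>L\<close> and vanish on the frozen blocks. In step \<open>t\<close>, add
  \<open>\<plusminus>e\<^sub>i\<close> to \<open>x\<close> and \<open>\<plusminus>Q e\<^sub>i\<close> to \<open>z\<close>, where \<open>i\<close> maximizes \<open>Q\<^sub>i\<^sub>i\<close> over the \<open>t\<close>-th block and the sign
  makes \<open>2\<langle>z, x\<rangle> - \<parallel>z\<parallel>\<^sup>2\<close> grow by at least \<open>Q\<^sub>i\<^sub>i\<close>. Since \<open>Q\<close> only decreases
  during the walk, at the end \<open>2\<langle>z, x\<rangle> - \<parallel>z\<parallel>\<^sup>2\<close> is at least \<open>1/n\<close> times the final trace of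
  \<open>Q\<close>, hence at least \<open>m/2\<close> minus the number of frozen blocks, and that number is at most \<open>\<parallel>z\<parallel>\<^sup>2\<close>.
\<close>

section \<open>Inner products, orthonormal systems and orthogonal projections\<close>

definition ip :: "nat \<Rightarrow> (nat \<Rightarrow> real) \<Rightarrow> (nat \<Rightarrow> real) \<Rightarrow> real"
  where "ip N x y = (\<Sum>i=1..N. x i * y i)"

definition orthonormal :: "nat \<Rightarrow> (nat \<Rightarrow> real) set \<Rightarrow> bool"
  where "orthonormal N C \<longleftrightarrow>
    finite C \<and> (\<forall>c\<in>C. \<forall>d\<in>C. ip N c d = (if c = d then 1 else 0))"

text \<open>For orthonormal \<open>C\<close> this projects \<open>v\<close> along \<open>C\<close>
  onto its orthogonal complement: the map \<open>Q\<close> of the walk.\<close>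

definition residual :: "nat \<Rightarrow> (nat \<Rightarrow> real) set \<Rightarrow> (nat \<Rightarrow> real) \<Rightarrow> nat \<Rightarrow> real"
  where "residual N C v = (\<lambda>j. v j - (\<Sum>c\<in>C. ip N v c * c j))"

definition unit_vec :: "nat \<Rightarrow> nat \<Rightarrow> real"
  where "unit_vec i = (\<lambda>j. if j = i then 1 else 0)"

lemma ip_commute: "ip N x y = ip N y x"
  by (simp add: ip_def mult.commute)

lemma ip_self_nonneg: "0 \<le> ip N x x"
  by (auto simp: ip_def intro: sum_nonneg)

lemma ip_self_eq_0_iff: "ip N x x = 0 \<longleftrightarrow> (\<forall>i\<in>{1..N}. x i = 0)"
  unfolding ip_def by (subst sum_nonneg_eq_0_iff) auto

lemma ip_lincomb_left:
  "ip N (\<lambda>j. a * x j + b * y j) w = a * ip N x w + b * ip N y w"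
  by (simp add: ip_def sum.distrib sum_distrib_left algebra_simps)

lemma ip_lincomb_right:
  "ip N w (\<lambda>j. a * x j + b * y j) = a * ip N w x + b * ip N w y"
  by (simp add: ip_def sum.distrib sum_distrib_left algebra_simps)

lemma ip_add_right: "ip N w (x + y) = ip N w x + ip N w y"
  by (simp add: ip_def sum.distrib algebra_simps)

lemma ip_diff_right: "ip N w (x - y) = ip N w x - ip N w y"
  by (simp add: ip_def sum_subtractf algebra_simps)

lemma ip_scaleR_right: "ip N w (a *\<^sub>R x) = a * ip N w x"
  by (simp add: ip_def scaleR_fun_def sum_distrib_left algebra_simps)

lemma ip_unit_vec_right: "i \<in> {1..N} \<Longrightarrow> ip N v (unit_vec i) = v i"
  by (simp add: ip_def unit_vec_def if_distrib cong: if_cong)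

lemma ip_unit_vec_left: "i \<in> {1..N} \<Longrightarrow> ip N (unit_vec i) v = v i"
  by (simp add: ip_commute ip_unit_vec_right)

lemma ip_span_eq_0:
  assumes "y \<in> span B" and "\<And>b. b \<in> B \<Longrightarrow> ip N v b = 0"
  shows "ip N v y = 0"
  using assms(1)
proof (induction rule: span_induct_alt)
  case base
  show ?case by (simp add: ip_def)
next
  case (step a x y)
  then show ?case using assms(2) by (simp only: ip_add_right ip_scaleR_right)
qed

lemma ip_residual_left:
  "ip N (residual N C v) w = ip N v w - (\<Sum>c\<in>C. ip N v c * ip N c w)"
proof -
  have "(\<Sum>i=1..N. (\<Sum>c\<in>C. ip N v c * c i) * w i) = (\<Sum>c\<in>C. ip N v c * ip N c w)"
    unfolding ip_def[of N _ w]
    by (simp add: sum_distrib_right sum_distrib_left mult.assoc) (rule sum.swap)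
  then show ?thesis
    by (simp add: ip_def[of N _ w] residual_def left_diff_distrib sum_subtractf)
qed

lemma residual_orthogonal:
  assumes "orthonormal N C" and "d \<in> C"
  shows "ip N (residual N C v) d = 0"
proof -
  have "(\<Sum>c\<in>C. ip N v c * ip N c d) = (\<Sum>c\<in>C. if c = d then ip N v c else 0)"
    using assms by (intro sum.cong) (auto simp: orthonormal_def)
  also have "\<dots> = ip N v d"
    using assms by (simp add: orthonormal_def)
  finally show ?thesis by (simp add: ip_residual_left)
qed

text \<open>The terms subtracted in the second argument are multiples of elements of
  \<open>C\<close>, to which the residual is orthogonal.\<close>

lemma ip_residual_residual:
  assumes "orthonormal N C"
  shows "ip N (residual N C v) (residual N C v) = ip N (residual N C v) v"
  using ip_residual_left[of N C v "residual N C v"] residual_orthogonal[OF assms]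
  by (simp add: ip_commute)

lemma ip_residual_unit_vec:
  assumes "i \<in> {1..N}"
  shows "ip N (residual N C (unit_vec i)) (unit_vec i) = 1 - (\<Sum>c\<in>C. (c i)\<^sup>2)"
  using assms
  by (simp add: ip_residual_left ip_unit_vec_left ip_unit_vec_right power2_eq_square)
    (simp add: unit_vec_def)

text \<open>The trace of the projection onto the span of \<open>C\<close> is the dimension of that
  span.\<close>

lemma sum_sq_orthonormal:
  assumes "orthonormal N C"
  shows "(\<Sum>i=1..N. \<Sum>c\<in>C. (c i)\<^sup>2) = card C"
proof -
  have "(\<Sum>i=1..N. \<Sum>c\<in>C. (c i)\<^sup>2) = (\<Sum>c\<in>C. ip N c c)"
    unfolding ip_def by (subst sum.swap) (simp add: power2_eq_square)
  also have "\<dots> = card C"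
    using assms by (simp add: orthonormal_def)
  finally show ?thesis .
qed

text \<open>One Gram-Schmidt step: normalize the residual of \<open>s\<close>, or keep
  \<open>C\<close> if that residual is null.\<close>

lemma orthonormal_extend_one:
  assumes C: "orthonormal N C"
  obtains D where "orthonormal N D" "C \<subseteq> D" "card D \<le> card C + 1"
    "\<And>v. (\<forall>c\<in>D. ip N v c = 0) \<Longrightarrow> ip N v s = 0"
proof -
  define r where "r = residual N C s"
  have ip_s: "ip N v s = ip N v r" if "\<forall>c\<in>C. ip N v c = 0" for v
    using that by (simp add: r_def ip_commute[of N v] ip_residual_left)
  show ?thesis
  proof (cases "ip N r r = 0")
    \<comment> \<open>\<open>ip N\<close> ignores coordinates outside \<open>{1..N}\<close>, so
      \<open>r\<close> is known to vanish only inside; this already makes every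
      \<open>ip N v r\<close> zero.\<close>
    case True
    then have "ip N v r = 0" for v
      by (simp add: ip_self_eq_0_iff) (simp add: ip_def)
    then show ?thesis using that[of C] C ip_s by simp
  next
    case False
    define a where "a = 1 / sqrt (ip N r r)"
    define b where "b = (\<lambda>j. a * r j)"
    have a: "a \<noteq> 0" "a * a * ip N r r = 1"
      using False ip_self_nonneg[of N r] by (auto simp: a_def field_simps)
    have b: "ip N v b = a * ip N v r" for v
      using ip_lincomb_right[of N v a r 0 r] by (simp add: b_def)
    have rC: "ip N r d = 0" if "d \<in> C" for d
      using residual_orthogonal[OF C that] by (simp add: r_def)
    have bC: "ip N d b = 0" "ip N b d = 0" if "d \<in> C" for d
      using rC[OF that] b[of d] by (simp_all add: ip_commute)
    have bb: "ip N b b = 1"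
      using a(2) b[of b] b[of r] by (simp add: ip_commute)
    have D: "orthonormal N (insert b C)"
      using C bC bb by (auto simp: orthonormal_def)
    have "ip N v s = 0" if "\<forall>c\<in>insert b C. ip N v c = 0" for v
      using that ip_s[of v] b[of v] a(1) by auto
    moreover have "card (insert b C) \<le> card C + 1"
      using C by (simp add: orthonormal_def card_insert_if)
    ultimately show ?thesis using that[of "insert b C"] D by blast
  qed
qed

lemma orthonormal_extend:
  assumes "finite S" "orthonormal N C"
  shows "\<exists>D. orthonormal N D \<and> C \<subseteq> D \<and> card D \<le> card C + card S \<and>
    (\<forall>v. (\<forall>c\<in>D. ip N v c = 0) \<longrightarrow> (\<forall>s\<in>S. ip N v s = 0))"
  using assms
proof (induction S)
  case empty
  then show ?case by auto
next
  case (insert s S)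
  then obtain D where D: "orthonormal N D" "C \<subseteq> D" "card D \<le> card C + card S"
    "\<forall>v. (\<forall>c\<in>D. ip N v c = 0) \<longrightarrow> (\<forall>s\<in>S. ip N v s = 0)" by auto
  obtain E where E: "orthonormal N E" "D \<subseteq> E" "card E \<le> card D + 1"
    "\<And>v. (\<forall>c\<in>E. ip N v c = 0) \<Longrightarrow> ip N v s = 0"
    using orthonormal_extend_one[OF D(1)] by metis
  show ?case
  proof (intro exI[of _ E] conjI allI impI)
    show "card E \<le> card C + card (insert s S)"
      using insert D(3) E(3) by simp
  next
    fix v assume "\<forall>c\<in>E. ip N v c = 0"
    then show "\<forall>s\<in>insert s S. ip N v s = 0" using D(4) E(2,4) by blast
  qed (use D E in auto)
qed

section \<open>Blocks and mixed norms\<close>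

lemma finite_block [simp]: "finite (block n s)"
  by (simp add: block_def)

lemma card_block: "s \<ge> 1 \<Longrightarrow> card (block n s) = n"
  by (cases s) (simp_all add: block_def)

lemma atLeastAtMost_Suc_mult: "{1..Suc t * n} = {1..t * n} \<union> block n (Suc t)"
  by (auto simp: block_def)

lemma block_subset:
  assumes "s \<in> {1..t}"
  shows "block n s \<subseteq> {1..t * n}"
proof -
  have "s * n \<le> t * n" using assms by simp
  then show ?thesis by (auto simp: block_def)
qed

lemma block_disjoint_initial: "t < s \<Longrightarrow> block n s \<inter> {1..t * n} = {}"
proof -
  assume "t < s"
  then have "t * n \<le> (s - 1) * n" by (intro mult_le_mono1) simp
  then show ?thesis unfolding block_def disjoint_iff atLeastAtMost_iff by linarith
qed

lemma sum_initial_Suc: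
  "(\<Sum>i=1..Suc t * n. f i) = (\<Sum>i=1..t * n. f i) + (\<Sum>i\<in>block n (Suc t). f i)"
  using block_disjoint_initial[of t "Suc t" n]
  by (subst atLeastAtMost_Suc_mult, subst sum.union_disjoint) auto

lemma sum_blocks:
  fixes f :: "nat \<Rightarrow> real"
  shows "(\<Sum>i=1..m * n. f i) = (\<Sum>s=1..m. \<Sum>i\<in>block n s. f i)"
proof (induction m)
  case (Suc m)
  then show ?case by (simp only: sum_initial_Suc) simp
qed simp

lemma L2_set_sq: "(L2_set x A)\<^sup>2 = (\<Sum>i\<in>A. (x i)\<^sup>2)"
  by (simp add: L2_set_def sum_nonneg)

lemma ip_self_blocks: "ip (m * n) z z = (\<Sum>s=1..m. (L2_set z (block n s))\<^sup>2)"
  unfolding ip_def L2_set_sq sum_blocks by (simp add: power2_eq_square)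

lemma L2_set_block_le:
  assumes "s \<in> {1..m}"
  shows "(L2_set z (block n s))\<^sup>2 \<le> ip (m * n) z z"
  unfolding ip_self_blocks using assms by (intro member_le_sum) auto

text \<open>Cauchy-Schwarz in each block. With block norms of \<open>z\<close> bounded, this is the
  duality that bounds the \<open>(2,1)\<close> norm from below.\<close>

lemma ip_le_blocks:
  "ip (m * n) z w \<le> (\<Sum>s=1..m. L2_set z (block n s) * L2_set w (block n s))"
  unfolding ip_def sum_blocks
proof (rule sum_mono)
  fix s
  have "(\<Sum>i\<in>block n s. z i * w i) \<le> (\<Sum>i\<in>block n s. \<bar>z i\<bar> * \<bar>w i\<bar>)"
    by (intro sum_mono) (simp flip: abs_mult)
  also have "\<dots> \<le> L2_set z (block n s) * L2_set w (block n s)"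
    by (rule L2_set_mult_ineq)
  finally show "(\<Sum>i\<in>block n s. z i * w i) \<le> L2_set z (block n s) * L2_set w (block n s)" .
qed

lemma lp_norm_2: "lp_norm 2 A x = L2_set x A"
  by (simp add: lp_norm_def L2_set_def powr_half_sqrt sum_nonneg powr_realpow')

lemma lp_norm_1: "lp_norm 1 A x = (\<Sum>i\<in>A. \<bar>x i\<bar>)"
  by (simp add: lp_norm_def sum_nonneg)

lemma mixed_norm_2_1: "mixed_norm 2 1 n m x = (\<Sum>s=1..m. L2_set x (block n s))"
  unfolding mixed_norm_def lp_norm_1 lp_norm_2 by simp

lemma mixed_norm_1_inf_le_1:
  assumes "\<forall>s\<in>{1..m}. (\<Sum>i\<in>block n s. \<bar>x i\<bar>) \<le> 1"
  shows "mixed_norm 1 \<infinity> n m x \<le> 1"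
  using assms unfolding mixed_norm_def lp_norm_1 by (auto simp: lp_norm_def)

section \<open>The walk\<close>

definition frozen :: "nat \<Rightarrow> nat \<Rightarrow> (nat \<Rightarrow> real) \<Rightarrow> nat set"
  where "frozen n m z = {s \<in> {1..m}. L2_set z (block n s) > 1}"

lemma finite_frozen [simp]: "finite (frozen n m z)"
  by (simp add: frozen_def)

lemma card_frozen_le: "card (frozen n m z) \<le> ip (m * n) z z"
proof -
  have "real (card (frozen n m z)) = (\<Sum>s\<in>frozen n m z. 1)" by simp
  also have "\<dots> \<le> (\<Sum>s\<in>frozen n m z. (L2_set z (block n s))\<^sup>2)"
    by (intro sum_mono) (simp add: frozen_def)
  also have "\<dots> \<le> ip (m * n) z z"
    unfolding ip_self_blocks by (intro sum_mono2) (auto simp: frozen_def)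
  finally show ?thesis .
qed

text \<open>
  The orthogonal complement of \<open>C\<close> is the range of the projection \<open>Q\<close>, and
  \<open>1 - (\<Sum>c\<in>C. (c i)\<^sup>2)\<close> is \<open>Q\<^sub>i\<^sub>i\<close>. The last clause refers to the current
  \<open>Q\<close> for all past blocks, so it is preserved when \<open>C\<close> grows.
\<close>

definition walk_inv ::
    "nat \<Rightarrow> nat \<Rightarrow> (nat \<Rightarrow> real) set \<Rightarrow> nat \<Rightarrow> (nat \<Rightarrow> real) \<Rightarrow> (nat \<Rightarrow> real)
      \<Rightarrow> (nat \<Rightarrow> real) set \<Rightarrow> bool"
  where "walk_inv n m B t x z C \<longleftrightarrow>
    orthonormal (m * n) C \<and>
    card C \<le> card B + n * card (frozen n m z) \<and>
    (\<forall>v. (\<forall>c\<in>C. ip (m * n) v c = 0) \<longrightarrow>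
      (\<forall>b\<in>B. ip (m * n) v b = 0) \<and> (\<forall>s\<in>frozen n m z. \<forall>i\<in>block n s. v i = 0)) \<and>
    (\<forall>b\<in>B. ip (m * n) z b = 0) \<and>
    (\<forall>s\<in>{1..m}. L2_set z (block n s) \<le> 2) \<and>
    (\<forall>s\<in>{1..m}. (\<Sum>i\<in>block n s. \<bar>x i\<bar>) \<le> 1) \<and>
    (\<forall>i. i \<notin> {1..t * n} \<longrightarrow> x i = 0) \<and>
    (\<Sum>i=1..t * n. 1 - (\<Sum>c\<in>C. (c i)\<^sup>2)) \<le> n * (2 * ip (m * n) z x - ip (m * n) z z)"

lemma walk_init:
  assumes "finite B"
  shows "\<exists>x z C. walk_inv n m B 0 x z C"
proof -
  obtain C where C: "orthonormal (m * n) C" "card C \<le> card B"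
    "\<forall>v. (\<forall>c\<in>C. ip (m * n) v c = 0) \<longrightarrow> (\<forall>s\<in>B. ip (m * n) v s = 0)"
    using orthonormal_extend[OF assms, of "m * n" "{}"] by (auto simp: orthonormal_def)
  have "frozen n m (\<lambda>_. 0) = {}"
    by (simp add: frozen_def L2_set_def)
  then have "walk_inv n m B 0 (\<lambda>_. 0) (\<lambda>_. 0) C"
    using C unfolding walk_inv_def by (simp add: ip_def L2_set_def)
  then show ?thesis by blast
qed

lemma exists_ge_average:
  fixes f :: "'a \<Rightarrow> real"
  assumes "finite A" "A \<noteq> {}"
  obtains a where "a \<in> A" "sum f A \<le> card A * f a"
proof -
  obtain a where a: "a \<in> A" "\<And>b. b \<in> A \<Longrightarrow> f b \<le> f a"
    using obtains_MAX[OF assms, of f] assms(1) by (metis Max_ge finite_imageI imageI)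
  then show ?thesis using that sum_bounded_above[of A f "f a"] by auto
qed

lemma walk_step:
  assumes inv: "walk_inv n m B t x z C" and t: "t < m" and n: "n \<ge> 1"
  shows "\<exists>x' z' D. walk_inv n m B (Suc t) x' z' D"
proof -
  let ?N = "m * n"
  define diag where "diag = (\<lambda>(C :: (nat \<Rightarrow> real) set) i. 1 - (\<Sum>c\<in>C. (c i)\<^sup>2))"
  have C: "orthonormal ?N C" "card C \<le> card B + n * card (frozen n m z)"
    and perp: "\<And>v b. \<lbrakk>\<And>c. c \<in> C \<Longrightarrow> ip ?N v c = 0; b \<in> B\<rbrakk> \<Longrightarrow> ip ?N v b = 0"
      "\<And>v s i. \<lbrakk>\<And>c. c \<in> C \<Longrightarrow> ip ?N v c = 0; s \<in> frozen n m z; i \<in> block n s\<rbrakk> \<Longrightarrow> v i = 0"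
    and zB: "\<And>b. b \<in> B \<Longrightarrow> ip ?N z b = 0"
    and z2: "\<And>s. s \<in> {1..m} \<Longrightarrow> L2_set z (block n s) \<le> 2"
    and x1: "\<And>s. s \<in> {1..m} \<Longrightarrow> (\<Sum>i\<in>block n s. \<bar>x i\<bar>) \<le> 1"
    and x0: "\<And>i. i \<notin> {1..t * n} \<Longrightarrow> x i = 0"
    and pot: "(\<Sum>i=1..t * n. diag C i) \<le> n * (2 * ip ?N z x - ip ?N z z)"
    using inv unfolding walk_inv_def diag_def by auto
  have "block n (Suc t) \<noteq> {}"
    using n card_block[of "Suc t" n] by auto
  \<comment> \<open>Since \<open>n * diag C i\<close> dominates the sum over the new block, one step
    pays for that whole block in the potential.\<close>
  then obtain i where i: "i \<in> block n (Suc t)"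
      "sum (diag C) (block n (Suc t)) \<le> n * diag C i"
    using exists_ge_average[of "block n (Suc t)" "diag C"] card_block[of "Suc t" n] by auto
  have iN: "i \<in> {1..?N}"
    using i(1) block_subset[of "Suc t" m n] t by auto
  define q where "q = residual ?N C (unit_vec i)"
  have qC: "ip ?N q c = 0" if "c \<in> C" for c
    using residual_orthogonal[OF C(1) that] by (simp add: q_def)
  have q_unit: "ip ?N q (unit_vec i) = diag C i"
    using ip_residual_unit_vec[OF iN] by (simp add: q_def diag_def)
  have qq: "ip ?N q q = diag C i"
    using ip_residual_residual[OF C(1)] q_unit by (simp add: q_def)
  have diag1: "diag C i \<le> 1"
    by (simp add: diag_def sum_nonneg)
  \<comment> \<open>The potential \<open>2<z,x> - |z|^2\<close> changes by
    \<open>2 \<sigma> T\<close> plus \<open>diag C i\<close>, so \<open>\<sigma>\<close> takes the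
    sign of \<open>T\<close>.\<close>
  define T where "T = ip ?N z (unit_vec i) + ip ?N q x - ip ?N z q"
  define \<sigma> :: real where "\<sigma> = (if T \<ge> 0 then 1 else - 1)"
  have \<sigma>: "\<sigma> * \<sigma> = 1" "\<bar>\<sigma>\<bar> = 1" "\<sigma> * T \<ge> 0"
    by (auto simp: \<sigma>_def)
  define x' where "x' = (\<lambda>j. 1 * x j + \<sigma> * unit_vec i j)"
  define z' where "z' = (\<lambda>j. 1 * z j + \<sigma> * q j)"
  have zx': "ip ?N z' x' = ip ?N z x + \<sigma> * ip ?N z (unit_vec i) + \<sigma> * ip ?N q x + \<sigma> * \<sigma> * diag C i"
    by (simp add: z'_def x'_def ip_lincomb_left[of _ 1, simplified]
        ip_lincomb_right[of _ _ 1, simplified] q_unit algebra_simps)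
  have zz': "ip ?N z' z' = ip ?N z z + 2 * \<sigma> * ip ?N z q + \<sigma> * \<sigma> * diag C i"
    by (simp add: z'_def ip_lincomb_left[of _ 1, simplified]
        ip_lincomb_right[of _ _ 1, simplified] qq ip_commute[of _ q z] algebra_simps)
  have "2 * ip ?N z' x' - ip ?N z' z' = 2 * ip ?N z x - ip ?N z z + 2 * (\<sigma> * T) + diag C i"
    unfolding zx' zz' T_def \<sigma>(1) by (simp add: algebra_simps)
  then have gain: "2 * ip ?N z x - ip ?N z z + diag C i \<le> 2 * ip ?N z' x' - ip ?N z' z'"
    using \<sigma>(3) by simp
  have pot': "(\<Sum>i=1..Suc t * n. diag C i) \<le> n * (2 * ip ?N z' x' - ip ?N z' z')"
  proof -
    have "(\<Sum>i=1..Suc t * n. diag C i) \<le> n * (2 * ip ?N z x - ip ?N z z + diag C i)"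
      unfolding sum_initial_Suc using pot i(2) by (simp add: distrib_left)
    also have "\<dots> \<le> n * (2 * ip ?N z' x' - ip ?N z' z')"
      using gain by (intro mult_left_mono) auto
    finally show ?thesis .
  qed
  \<comment> \<open>\<open>q\<close> is orthogonal to \<open>C\<close>, hence zero on frozen blocks:
    these no longer change and stay frozen.\<close>
  have z'_frozen: "L2_set z' (block n s) = L2_set z (block n s)" if "s \<in> frozen n m z" for s
    using perp(2)[OF qC that] by (intro L2_set_cong) (auto simp: z'_def)
  have frozen_mono: "frozen n m z \<subseteq> frozen n m z'"
    using z'_frozen by (auto simp: frozen_def)
  have z'2: "L2_set z' (block n s) \<le> 2" if s: "s \<in> {1..m}" for s
  proof (cases "s \<in> frozen n m z")
    case True
    then show ?thesis using z'_frozen z2[OF s] by simp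
  next
    case False
    \<comment> \<open>An unfrozen block has norm at most 1, and \<open>q\<close> adds at most 1
      because \<open>|q|^2 = diag C i \<le> 1\<close>.\<close>
    have "L2_set z' (block n s) \<le> L2_set z (block n s) + L2_set (\<lambda>j. \<sigma> * q j) (block n s)"
      unfolding z'_def using L2_set_triangle_ineq[of z "\<lambda>j. \<sigma> * q j"] by simp
    also have "L2_set (\<lambda>j. \<sigma> * q j) (block n s) = L2_set q (block n s)"
      by (simp add: \<sigma>_def L2_set_def)
    also have "L2_set q (block n s) \<le> 1"
    proof (rule power2_le_imp_le)
      show "(L2_set q (block n s))\<^sup>2 \<le> 1\<^sup>2"
        using L2_set_block_le[OF s, of q n] qq diag1 by simp
    qed simp
    finally show ?thesis using False s by (simp add: frozen_def)
  qed
  \<comment> \<open>Vanishing on the newly frozen blocks means orthogonality to their unit vectors,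
    \<open>n\<close> for each block.\<close>
  define S where "S = unit_vec ` (\<Union>s\<in>frozen n m z' - frozen n m z. block n s)"
  have "card S \<le> card (\<Union>s\<in>frozen n m z' - frozen n m z. block n s)"
    unfolding S_def by (intro card_image_le) simp
  also have "\<dots> \<le> (\<Sum>s\<in>frozen n m z' - frozen n m z. card (block n s))"
    by (intro card_UN_le) simp
  also have "\<dots> = (\<Sum>s\<in>frozen n m z' - frozen n m z. n)"
    by (intro sum.cong) (auto simp: frozen_def card_block)
  finally have cardS: "card S \<le> n * (card (frozen n m z') - card (frozen n m z))"
    using frozen_mono by (simp add: card_Diff_subset mult.commute)
  have "finite S" by (simp add: S_def)
  then obtain D where D: "orthonormal ?N D" "C \<subseteq> D" "card D \<le> card C + card S"
    "\<forall>v. (\<forall>c\<in>D. ip ?N v c = 0) \<longrightarrow> (\<forall>s\<in>S. ip ?N v s = 0)"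
    using orthonormal_extend[OF _ C(1)] by blast
  have "walk_inv n m B (Suc t) x' z' D"
    unfolding walk_inv_def
  proof (intro conjI allI impI ballI)
    show "orthonormal ?N D" by fact
    \<comment> \<open>Makes the truncated subtraction in \<open>cardS\<close> exact.\<close>
    have "n * card (frozen n m z) \<le> n * card (frozen n m z')"
      using frozen_mono by (intro mult_le_mono2 card_mono) auto
    then show "card D \<le> card B + n * card (frozen n m z')"
      using D(3) C(2) cardS unfolding diff_mult_distrib2 by linarith
  next
    fix v b assume "\<forall>c\<in>D. ip ?N v c = 0" "b \<in> B"
    then show "ip ?N v b = 0" using perp(1) D(2) by blast
  next
    fix v s j assume v: "\<forall>c\<in>D. ip ?N v c = 0" and s: "s \<in> frozen n m z'" and j: "j \<in> block n s"
    show "v j = 0"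
    proof (cases "s \<in> frozen n m z")
      case True
      then show ?thesis using perp(2) v j D(2) by blast
    next
      case False
      then have "unit_vec j \<in> S" using s j by (auto simp: S_def)
      moreover have "j \<in> {1..?N}"
        using s j block_subset[of s m n] by (auto simp: frozen_def)
      ultimately show ?thesis using D(4) v ip_unit_vec_right by metis
    qed
  next
    fix b assume "b \<in> B"
    then show "ip ?N z' b = 0"
      using zB perp(1)[OF qC] by (simp only: z'_def ip_lincomb_left)
  next
    fix s assume "s \<in> {1..m}"
    then show "L2_set z' (block n s) \<le> 2" by (rule z'2)
  next
    fix s assume s: "s \<in> {1..m}"
    show "(\<Sum>j\<in>block n s. \<bar>x' j\<bar>) \<le> 1"
    proof (cases "s = Suc t")
      case True
      \<comment> \<open>Before this step \<open>x\<close> is zero on the new block, so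
        \<open>x'\<close> has the single entry \<open>\<sigma>\<close> there.\<close>
      have "(\<Sum>j\<in>block n s. \<bar>x' j\<bar>) = (\<Sum>j\<in>block n s. if j = i then 1 else 0)"
        using block_disjoint_initial[of t s n] True x0 \<sigma>(2)
        by (intro sum.cong) (auto simp: x'_def unit_vec_def disjoint_iff)
      then show ?thesis by simp
    next
      case False
      have "i \<notin> block n s"
      proof (cases "s < Suc t")
        case True
        then show ?thesis
          using i(1) s block_subset[of s t n] block_disjoint_initial[of t "Suc t" n] by auto
      next
        case False
        then have "Suc t < s" using \<open>s \<noteq> Suc t\<close> by simp
        then show ?thesis
          using i(1) block_subset[of "Suc t" "Suc t" n] block_disjoint_initial[of "Suc t" s n]
          by auto
      qed
      then have "(\<Sum>j\<in>block n s. \<bar>x' j\<bar>) = (\<Sum>j\<in>block n s. \<bar>x j\<bar>)"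
        by (intro sum.cong) (auto simp: x'_def unit_vec_def)
      then show ?thesis using x1[OF s] by simp
    qed
  next
    fix j assume "j \<notin> {1..Suc t * n}"
    then have "j \<noteq> i" "x j = 0"
      using i(1) x0[of j] unfolding atLeastAtMost_Suc_mult by auto
    then show "x' j = 0" by (simp add: x'_def unit_vec_def)
  next
    \<comment> \<open>Passing from \<open>C\<close> to \<open>D\<close> only subtracts more squares
      from each diagonal entry.\<close>
    have "(\<Sum>i=1..Suc t * n. diag D i) \<le> (\<Sum>i=1..Suc t * n. diag C i)"
      using D(1,2) unfolding diag_def orthonormal_def
      by (intro sum_mono diff_left_mono sum_mono2) auto
    with pot' show "(\<Sum>i=1..Suc t * n. 1 - (\<Sum>c\<in>D. (c i)\<^sup>2))
        \<le> n * (2 * ip ?N z' x' - ip ?N z' z')"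
      unfolding diag_def by linarith
  qed
  then show ?thesis by blast
qed

lemma walk_exists:
  assumes "finite B" "n \<ge> 1" "t \<le> m"
  shows "\<exists>x z C. walk_inv n m B t x z C"
  using assms(3)
proof (induction t)
  case 0
  show ?case by (rule walk_init[OF assms(1)])
next
  case (Suc t)
  then show ?case using walk_step[OF _ _ assms(2)] by (metis Suc_leD Suc_le_lessD)
qed

section \<open>Duality and the lower bound for the width\<close>

lemma dual_certificate:
  assumes B: "finite B" "card B \<le> m * n div 2" and n: "n \<ge> 1"
  obtains x z where "x \<in> mixed_ball 1 \<infinity> n m" "\<And>b. b \<in> B \<Longrightarrow> ip (m * n) z b = 0"
    "\<And>s. s \<in> {1..m} \<Longrightarrow> L2_set z (block n s) \<le> 2" "real m / 4 \<le> ip (m * n) z x"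
proof -
  let ?N = "m * n"
  obtain x z C where inv: "walk_inv n m B m x z C"
    using walk_exists[OF B(1) n, of m m] by auto
  let ?F = "real (card (frozen n m z))"
  have "real (card C) \<le> card B + n * ?F"
    using inv unfolding walk_inv_def
    by (metis of_nat_add of_nat_le_iff of_nat_mult)
  moreover have "real (card B) \<le> n * (m / 2)"
  proof -
    have "2 * card B \<le> m * n" using B(2) by linarith
    then have "real (2 * card B) \<le> real (m * n)" by (rule of_nat_mono)
    then show ?thesis by (simp add: mult.commute)
  qed
  moreover have "(\<Sum>i=1..?N. 1 - (\<Sum>c\<in>C. (c i)\<^sup>2)) = real n * m - card C"
    using inv sum_sq_orthonormal[of ?N C] by (simp add: walk_inv_def sum_subtractf)
  moreover have "(\<Sum>i=1..?N. 1 - (\<Sum>c\<in>C. (c i)\<^sup>2)) \<le> n * (2 * ip ?N z x - ip ?N z z)"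
    using inv by (simp add: walk_inv_def)
  \<comment> \<open>The final trace \<open>n * m - card C\<close> is at least
    \<open>n * (m / 2 - ?F)\<close>: \<open>B\<close> uses at most half of the dimension and each
    frozen block at most \<open>n\<close> more.\<close>
  ultimately have "real n * (m / 2 - ?F) \<le> n * (2 * ip ?N z x - ip ?N z z)"
    by (simp add: algebra_simps)
  then have "m / 2 - ?F \<le> 2 * ip ?N z x - ip ?N z z"
    using n by simp
  \<comment> \<open>The loss \<open>?F\<close> is at most \<open>|z|^2\<close>, so it cancels
    against the same term of the potential, leaving \<open>m / 2 \<le> 2<z,x>\<close>.\<close>
  then have "real m / 4 \<le> ip ?N z x"
    using card_frozen_le[of n m z] by simp
  moreover have "x \<in> mixed_ball 1 \<infinity> n m"
    using inv mixed_norm_1_inf_le_1[where x = x and n = n and m = m]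
    by (simp add: mixed_ball_def coord_space_def walk_inv_def)
  ultimately show ?thesis using that[of x z] inv by (simp add: walk_inv_def)
qed

theorem mainTheorem1:
  shows "\<exists>c::real. c > 0 \<and>
    (\<forall>m n::nat. m \<ge> 1 \<longrightarrow> n \<ge> 1 \<longrightarrow>
      kolmogorov_width (m * n div 2) (mixed_ball 1 \<infinity> n m) (coord_space (m * n)) (mixed_norm 2 1 n m)
        \<ge> ereal (c * real m))"
\<comment> \<open>The constant is the bound \<open>1/4\<close> on \<open><z,x> / m\<close> divided
  by the bound 2 on the block norms of \<open>z\<close>.\<close>
proof (intro exI[of _ "1 / 8"] conjI allI impI)
  fix m n :: nat
  assume n: "n \<ge> 1"
  let ?N = "m * n"
  show "ereal (1 / 8 * real m)
    \<le> kolmogorov_width (?N div 2) (mixed_ball 1 \<infinity> n m) (coord_space ?N) (mixed_norm 2 1 n m)"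
    unfolding kolmogorov_width_def
  proof (rule INF_greatest)
    fix L :: "(nat \<Rightarrow> real) set"
    assume "L \<in> {L. subspace L \<and> L \<subseteq> coord_space ?N \<and> (\<exists>B. finite B \<and> L = span B)
      \<and> dim L \<le> ?N div 2}"
    then obtain G where G: "finite G" "L = span G" and dimL: "dim L \<le> ?N div 2"
      by blast
    \<comment> \<open>\<open>G\<close> may have more than \<open>dim L\<close> elements, so a basis
      replaces it; \<open>G\<close> still shows that the basis is finite.\<close>
    obtain B where B: "B \<subseteq> L" "independent B" "L \<subseteq> span B" "card B = dim L"
      using basis_exists by blast
    have "finite B"
      using independent_span_bound[OF G(1) B(2)] B(1) G(2) by blast
    then obtain x z where x: "x \<in> mixed_ball 1 \<infinity> n m"
      and zB: "\<And>b. b \<in> B \<Longrightarrow> ip ?N z b = 0"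
      and z2: "\<And>s. s \<in> {1..m} \<Longrightarrow> L2_set z (block n s) \<le> 2"
      and zx: "real m / 4 \<le> ip ?N z x"
      using dual_certificate[OF _ _ n, of B m] B(4) dimL by metis
    have "ereal (1 / 8 * real m) \<le> (INF y\<in>L. ereal (mixed_norm 2 1 n m (x - y)))"
    proof (rule INF_greatest)
      fix y assume "y \<in> L"
      then have "ip ?N z y = 0"
        using ip_span_eq_0[of y B] zB B(3) by blast
      then have "real m / 4 \<le> ip ?N z (x - y)"
        using zx by (simp add: ip_diff_right)
      also have "\<dots> \<le> (\<Sum>s=1..m. L2_set z (block n s) * L2_set (x - y) (block n s))"
        by (rule ip_le_blocks)
      also have "\<dots> \<le> (\<Sum>s=1..m. 2 * L2_set (x - y) (block n s))"
        using z2 by (intro sum_mono mult_right_mono) auto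
      also have "\<dots> = 2 * mixed_norm 2 1 n m (x - y)"
        unfolding mixed_norm_2_1 by (simp add: sum_distrib_left)
      finally show "ereal (1 / 8 * real m) \<le> ereal (mixed_norm 2 1 n m (x - y))"
        by simp
    qed
    also have "\<dots> \<le> (SUP x\<in>mixed_ball 1 \<infinity> n m. INF y\<in>L. ereal (mixed_norm 2 1 n m (x - y)))"
      using x by (rule SUP_upper)
    finally show "ereal (1 / 8 * real m)
      \<le> (SUP x\<in>mixed_ball 1 \<infinity> n m. INF y\<in>L. ereal (mixed_norm 2 1 n m (x - y)))" .
  qed
qed simp

end
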